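(* Let $n\ge 1$, $0\le k\le n$ and $1\le i\le n$. There is an order of the basis $B_i$ and an order of the basis $B_{i-1}$ such that the change of basis matrix $[B_i]_{B_{i-1}}$ is block-diagonal with all blocks of size at most two.
   Context: Let $X$ be the set of words $w_1\dots w_n$ in the alphabet $\{1,2\}$ with exactly $k$ letters $1$ (the word corresponds to the $k$-subset $\{j: w_j=1\}$ of $\{1,\dots,n\}$). The symmetric group $S_n$ acts on $X$ via its action on $k$-subsets. $\mathcal F$ is the space of complex functions on $X$, with $\sigma f=f\circ\sigma^{-1}$ and the inner product for which the delta functions $\delta(x)$, $x\in X$, are orthonormal. For $i\le n$, $S_i\subset S_n$ is the subgroup fixing $i+1,\dots,n$; irreducible representations of $S_i$ are indexed by Young diagrams with $i$ boxes in the usual way ($(i)$ is the trivial representation), and $\mathcal F_{i,\lambda}$ is the $\lambda$-isotypic component of $\mathcal F$ as an $S_i$-module. Write $\lambda\nearrow\mu$ if $\mu$ is obtained from $\lambda$ by adding one box. For Young diagrams $\lambda_1,\dots,\lambda_p$ with $\lambda_j$ having $j$ boxes, $\mathcal F_{\lambda_1\dots\lambda_p}=\mathcal F_{1,\lambda_1}\cap\dots\cap\mathcal F_{p,\lambda_p}$. For a word $c_q\dots c_n$ in $\{1,2\}$, $\mathcal F^{c_q\dots c_n}$ is the span of the $\delta(w)$ with $w\in X$, $w_q\dots w_n=c_q\dots c_n$; for $q=n+1$ (empty word) it is $\mathcal F$. Put $\mathcal F_{\lambda_1\dots\lambda_p}^{c_q\dots c_n}=\mathcal F_{\lambda_1\dots\lambda_p}\cap\mathcal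 F^{c_q\dots c_n}$ (for $p=0$ this means $\mathcal F^{c_q\dots c_n}$). For $0\le i\le n$, $\mathcal F$ is the orthogonal direct sum of the one-dimensional subspaces $\mathcal F_{\lambda_1\dots\lambda_i}^{c_{i+1}\dots c_n}$, over all words $c_{i+1}\dots c_n$ with exactly $k-r$ letters $1$ for some $0\le r\le k$, and all chains $\lambda_1\nearrow\dots\nearrow\lambda_i$ with $\lambda_i=(i-a,a)$, $0\le a\le\min(r,i-r)$. The $i$-th intermediate basis $B_i$ is a basis of $\mathcal F$ obtained by choosing one unit vector in each of these subspaces (it is unique up to scalars). $[B]_{B'}$ denotes the change of basis matrix, whose columns are the elements of $B$ written in the basis $B'$. *)

theory Defs
  imports Complex_Main "HOL-Library.Function_Algebras" "HOL-Combinatorics.Permutations"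
    "Jordan_Normal_Form.Matrix"
begin

definition cscale :: "complex \<Rightarrow> ('a \<Rightarrow> complex) \<Rightarrow> 'a \<Rightarrow> complex" where
  "cscale a f = (\<lambda>x. a * f x)"

interpretation cfun: vector_space cscale
  by unfold_locales (auto simp: cscale_def fun_eq_iff algebra_simps)

definition delta :: "'a \<Rightarrow> 'a \<Rightarrow> complex" where
  "delta x = (\<lambda>y. if y = x then 1 else 0)"


text \<open>Positions in words are counted from 0: the letter $w_{j+1}$ is \<open>w ! j\<close>, and the
  symmetric group $S_i$ consists of the \<open>\<sigma>\<close> with \<open>\<sigma> permutes {..<i}\<close>; this contains the
  embedding of $S_i$ into $S_n$, since a permutation of \<open>{..<i}\<close> fixes all \<open>j \<ge> i\<close>.\<close>

definition words :: "nat \<Rightarrow> nat \<Rightarrow> nat list set" where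
  "words n k = {w. length w = n \<and> set w \<subseteq> {1, 2} \<and> count_list w 1 = k}"

text \<open>The letter of \<open>w\<close> at position \<open>j\<close> is moved to position \<open>\<sigma> j\<close>.\<close>

definition word_act :: "(nat \<Rightarrow> nat) \<Rightarrow> nat list \<Rightarrow> nat list" where
  "word_act \<sigma> w = permute_list (Hilbert_Choice.inv \<sigma>) w"

lemma word_act_subset:
  assumes "\<sigma> permutes {..<length w}"
  shows "{j. j < length w \<and> word_act \<sigma> w ! j = a} = \<sigma> ` {j. j < length w \<and> w ! j = a}"
proof -
  have inv: "Hilbert_Choice.inv \<sigma> permutes {..<length w}"
    using assms by (rule permutes_inv)
  have less: "Hilbert_Choice.inv \<sigma> j < length w \<longleftrightarrow> j < length w" for j
    using permutes_in_image[OF inv, of j] by simp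
  show ?thesis
    using less permutes_in_image[OF assms] permutes_inverses[OF assms]
    by (auto simp: word_act_def permute_list_nth[OF inv] image_iff) metis
qed

definition fun_act :: "(nat \<Rightarrow> nat) \<Rightarrow> (nat list \<Rightarrow> complex) \<Rightarrow> nat list \<Rightarrow> complex" where
  "fun_act \<sigma> f = f \<circ> word_act (Hilbert_Choice.inv \<sigma>)"

text \<open>Functions on \<open>words n k\<close> are represented by their extension by zero to all lists.\<close>

definition fun_space :: "nat \<Rightarrow> nat \<Rightarrow> (nat list \<Rightarrow> complex) set" where
  "fun_space n k = {f. \<forall>w. w \<notin> words n k \<longrightarrow> f w = 0}"

definition cinner :: "nat \<Rightarrow> nat \<Rightarrow> (nat list \<Rightarrow> complex) \<Rightarrow> (nat list \<Rightarrow> complex) \<Rightarrow> complex" where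
  "cinner n k f g = (\<Sum>w\<in>words n k. f w * cnj (g w))"


text \<open>A Young diagram is given by its list of (positive, weakly decreasing) row lengths.\<close>

definition young_diagram :: "nat \<Rightarrow> nat list \<Rightarrow> bool" where
  "young_diagram m \<mu> \<longleftrightarrow> sorted_wrt (\<ge>) \<mu> \<and> 0 \<notin> set \<mu> \<and> sum_list \<mu> = m"

definition boxes :: "nat list \<Rightarrow> (nat \<times> nat) set" where
  "boxes \<mu> = {(r, c). r < length \<mu> \<and> c < \<mu> ! r}"

definition add_box :: "nat list \<Rightarrow> nat list \<Rightarrow> bool" where
  "add_box \<mu> \<nu> \<longleftrightarrow> (\<exists>b. b \<notin> boxes \<mu> \<and> boxes \<nu> = insert b (boxes \<mu>))"

definition two_rows :: "nat \<Rightarrow> nat \<Rightarrow> nat list" where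
  "two_rows m a = filter (\<lambda>x. x \<noteq> 0) [m - a, a]"


text \<open>The irreducible representation of the symmetric group indexed by \<open>\<mu>\<close> is the Specht module.
  A tableau is given by the map \<open>t\<close> sending each entry to its (row, column) position, so the
  tableau \<open>\<pi>t\<close>, in which every entry \<open>j\<close> is replaced by \<open>\<pi> j\<close>, is \<open>t\<close> composed with the inverse
  of \<open>\<pi>\<close>. A tabloid (row equivalence class of tableaux) is the word listing the rows of the
  entries \<open>0, 1, \<dots>\<close>; hence the action on functions of tabloids is again \<open>fun_act\<close>.\<close>

definition tableau :: "nat list \<Rightarrow> (nat \<Rightarrow> nat \<times> nat) \<Rightarrow> bool" where
  "tableau \<mu> t \<longleftrightarrow> bij_betw t {..<sum_list \<mu>} (boxes \<mu>)"

definition tabloid :: "nat list \<Rightarrow> (nat \<Rightarrow> nat \<times> nat) \<Rightarrow> nat list" where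
  "tabloid \<mu> t = map (\<lambda>j. fst (t j)) [0..<sum_list \<mu>]"

definition column_stabilizer :: "nat list \<Rightarrow> (nat \<Rightarrow> nat \<times> nat) \<Rightarrow> (nat \<Rightarrow> nat) set" where
  "column_stabilizer \<mu> t =
    {\<pi>. \<pi> permutes {..<sum_list \<mu>} \<and> (\<forall>j<sum_list \<mu>. snd (t (\<pi> j)) = snd (t j))}"

definition polytabloid :: "nat list \<Rightarrow> (nat \<Rightarrow> nat \<times> nat) \<Rightarrow> nat list \<Rightarrow> complex" where
  "polytabloid \<mu> t =
    (\<Sum>\<pi>\<in>column_stabilizer \<mu> t.
      cscale (of_int (sign \<pi>)) (delta (tabloid \<mu> (t \<circ> Hilbert_Choice.inv \<pi>))))"

definition specht :: "nat list \<Rightarrow> (nat list \<Rightarrow> complex) set" where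
  "specht \<mu> = cfun.span {polytabloid \<mu> t |t. tableau \<mu> t}"

definition submodule :: "nat \<Rightarrow> (nat list \<Rightarrow> complex) set \<Rightarrow> bool" where
  "submodule i U \<longleftrightarrow>
    cfun.subspace U \<and> (\<forall>\<sigma> f. \<sigma> permutes {..<i} \<longrightarrow> f \<in> U \<longrightarrow> fun_act \<sigma> f \<in> U)"

text \<open>There is no loss in requiring the isomorphism to be the restriction of a linear map defined
  on all functions, since linear maps extend from subspaces.\<close>

definition rep_iso :: "nat \<Rightarrow> (nat list \<Rightarrow> complex) set \<Rightarrow> (nat list \<Rightarrow> complex) set \<Rightarrow> bool" where
  "rep_iso i U V \<longleftrightarrow>
    (\<exists>\<phi>. Vector_Spaces.linear cscale cscale \<phi> \<and> bij_betw \<phi> U V \<and>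
      (\<forall>\<sigma> u. \<sigma> permutes {..<i} \<longrightarrow> u \<in> U \<longrightarrow> \<phi> (fun_act \<sigma> u) = fun_act \<sigma> (\<phi> u)))"

definition isotypic :: "nat \<Rightarrow> nat \<Rightarrow> nat \<Rightarrow> nat list \<Rightarrow> (nat list \<Rightarrow> complex) set" where
  "isotypic n k i \<mu> =
    cfun.span (\<Union>{U. U \<subseteq> fun_space n k \<and> submodule i U \<and> rep_iso i U (specht \<mu>)})"


text \<open>In a list \<open>ls\<close> of Young diagrams the entry \<open>ls ! j\<close> is $\lambda_{j+1}$; a suffix \<open>c\<close> of length
  $m$ stands for the word $c_{n-m+1}\dots c_n$.\<close>

definition chain_space :: "nat \<Rightarrow> nat \<Rightarrow> nat list list \<Rightarrow> (nat list \<Rightarrow> complex) set" where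
  "chain_space n k ls =
    {f \<in> fun_space n k. \<forall>j<length ls. f \<in> isotypic n k (Suc j) (ls ! j)}"

definition suffix_space :: "nat \<Rightarrow> nat \<Rightarrow> nat list \<Rightarrow> (nat list \<Rightarrow> complex) set" where
  "suffix_space n k c = cfun.span (delta ` {w \<in> words n k. drop (n - length c) w = c})"

definition young_chain :: "nat \<Rightarrow> nat list list \<Rightarrow> bool" where
  "young_chain i ls \<longleftrightarrow> length ls = i \<and> (\<forall>j<i. young_diagram (Suc j) (ls ! j)) \<and>
    (\<forall>j. Suc j < i \<longrightarrow> add_box (ls ! j) (ls ! Suc j))"

text \<open>The bound $a \le \min(r, i-r)$ is stated without truncated subtraction. For \<open>i = 0\<close> it forces
  \<open>r = a = 0\<close>, and the condition on the last diagram is void.\<close>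

definition basis_index :: "nat \<Rightarrow> nat \<Rightarrow> nat \<Rightarrow> (nat list list \<times> nat list) set" where
  "basis_index n k i =
    {(ls, c). young_chain i ls \<and> length c = n - i \<and> set c \<subseteq> {1, 2} \<and>
      (\<exists>r a. r \<le> k \<and> count_list c 1 = k - r \<and> a \<le> r \<and> a + r \<le> i \<and>
        (i > 0 \<longrightarrow> last ls = two_rows i a))}"

definition intermediate_basis :: "nat \<Rightarrow> nat \<Rightarrow> nat \<Rightarrow> (nat list \<Rightarrow> complex) set \<Rightarrow> bool" where
  "intermediate_basis n k i B \<longleftrightarrow>
    cfun.independent B \<and> cfun.span B = fun_space n k \<and>
    (\<exists>v. bij_betw v (basis_index n k i) B \<and>
      (\<forall>(ls, c)\<in>basis_index n k i.
        v (ls, c) \<in> chain_space n k ls \<inter> suffix_space n k c \<and>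
        cinner n k (v (ls, c)) (v (ls, c)) = 1))"

definition change_of_basis_mat ::
    "(nat list \<Rightarrow> complex) list \<Rightarrow> (nat list \<Rightarrow> complex) list \<Rightarrow> complex mat" where
  "change_of_basis_mat bs bs' =
    mat (length bs') (length bs) (\<lambda>(p, q). cfun.representation (set bs') (bs ! q) (bs' ! p))"

end

theory Submission
  imports Defs
begin

text \<open>An element of $B_i$ indexed by a chain $\lambda_1\nearrow\dots\nearrow\lambda_i$ and a suffix
  $c$ is a combination of the at most two elements of $B_{i-1}$ indexed by
  $\lambda_1\nearrow\dots\nearrow\lambda_{i-1}$ and a suffix $1c$ or $2c$. This holds because
  $B_{i-1}$ is orthonormal and because vectors with different suffixes or in different isotypic
  components are orthogonal. No Schur lemma is needed for the latter: the sum of all transpositions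
  of $S_m$ is self-adjoint and acts on the Specht module of $\mu$ by a scalar (twice the content
  sum, up to a shift depending on $m$), and this scalar tells apart diagrams with at most two rows,
  the only ones that occur.\<close>

section \<open>Block-diagonal matrices from bases partitioned by keys\<close>

lemma sum_fun_apply: "(\<Sum>a\<in>A. f a) x = (\<Sum>a\<in>A. f a x)"
  for f :: "'b \<Rightarrow> 'a \<Rightarrow> 'c::comm_monoid_add"
  by (induction A rule: infinite_finite_induct) auto

lemma sum_rotate3:
  "(\<Sum>x\<in>A. \<Sum>y\<in>B. \<Sum>z\<in>C. g x y z) = (\<Sum>z\<in>C. \<Sum>x\<in>A. \<Sum>y\<in>B. g x y z)"
  by (rule trans[OF sum.cong[OF refl sum.swap] sum.swap])

text \<open>Induction on the keys: the first key splits off a corner, and both rectangles beside it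
  vanish because their row and column keys differ. Blocks may still be rectangular or empty at this
  stage.\<close>

lemma mat_concat_eq_diag_block_mat:
  assumes "distinct ps"
    and "\<And>p q x y. p \<in> set ps \<Longrightarrow> q \<in> set ps \<Longrightarrow> p \<noteq> q \<Longrightarrow> x \<in> set (L' p) \<Longrightarrow> y \<in> set (L q) \<Longrightarrow>
      g x y = 0"
  shows "mat (length (concat (map L' ps))) (length (concat (map L ps)))
      (\<lambda>(i, j). g (concat (map L' ps) ! i) (concat (map L ps) ! j)) =
    diag_block_mat (map (\<lambda>p. mat (length (L' p)) (length (L p))
      (\<lambda>(i, j). g (L' p ! i) (L p ! j))) ps)"
  using assms
proof (induction ps)
  case Nil
  show ?case by (auto intro: eq_matI)
next
  case (Cons p ps)
  let ?R = "concat (map L' ps)" and ?C = "concat (map L ps)"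
  have IH: "diag_block_mat (map (\<lambda>p. mat (length (L' p)) (length (L p))
      (\<lambda>(i, j). g (L' p ! i) (L p ! j))) ps) =
    mat (length ?R) (length ?C) (\<lambda>(i, j). g (?R ! i) (?C ! j))"
    by (rule Cons.IH[symmetric]) (use Cons.prems in auto)
  have right: "g x y = 0" if "x \<in> set (L' p)" "y \<in> set ?C" for x y
  proof -
    obtain q where q: "q \<in> set ps" "y \<in> set (L q)"
      using \<open>y \<in> set ?C\<close> by auto
    then have "p \<noteq> q" using Cons.prems(1) by auto
    then show ?thesis using Cons.prems(2)[of p q x y] q that by auto
  qed
  have left: "g x y = 0" if "x \<in> set ?R" "y \<in> set (L p)" for x y
  proof -
    obtain q where q: "q \<in> set ps" "x \<in> set (L' q)"
      using \<open>x \<in> set ?R\<close> by auto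
    then have "q \<noteq> p" using Cons.prems(1) by auto
    then show ?thesis using Cons.prems(2)[of q p x y] q that by auto
  qed
  have right': "g (L' p ! i) (?C ! j) = 0" if "i < length (L' p)" "j < length ?C" for i j
    using that by (intro right nth_mem)
  have left': "g (?R ! i) (L p ! j) = 0" if "i < length ?R" "j < length (L p)" for i j
    using that by (intro left nth_mem)
  show ?case
    unfolding list.map diag_block_mat.simps Let_def IH concat.simps length_append
    by (rule eq_matI) (auto simp: nth_append intro!: left' right')
qed

lemma distinct_concat_map:
  assumes "distinct ps" and "\<And>p. p \<in> set ps \<Longrightarrow> distinct (L p)"
    and "\<And>p q. p \<in> set ps \<Longrightarrow> q \<in> set ps \<Longrightarrow> p \<noteq> q \<Longrightarrow> set (L p) \<inter> set (L q) = {}"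
  shows "distinct (concat (map L ps))"
  using assms
proof (induction ps)
  case (Cons p ps)
  then have "distinct (concat (map L ps))" by auto
  moreover have "set (L p) \<inter> set (L q) = {}" if "q \<in> set ps" for q
    using Cons.prems(1) that by (intro Cons.prems(3)) auto
  ultimately show ?case using Cons.prems(2) by auto
qed simp

text \<open>The blocks are square because independence bounds the number of columns of each block by its
  number of rows, while the total numbers of rows and columns agree.\<close>

lemma change_of_basis_block_diagonal:
  fixes \<kappa> \<kappa>' :: "(nat list \<Rightarrow> complex) \<Rightarrow> 'p"
  assumes ind: "cfun.independent B" "cfun.independent B'" and fin: "finite B" "finite B'"
    and span: "cfun.span B = cfun.span B'"
    and rep: "\<And>b b'. b \<in> B \<Longrightarrow> b' \<in> B' \<Longrightarrow> cfun.representation B' b b' \<noteq> 0 \<Longrightarrow> \<kappa> b = \<kappa>' b'"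
    and card: "\<And>p. card {b' \<in> B'. \<kappa>' b' = p} \<le> d"
  shows "\<exists>bs bs' Ms. distinct bs \<and> set bs = B \<and> distinct bs' \<and> set bs' = B' \<and>
    change_of_basis_mat bs bs' = diag_block_mat Ms \<and>
    (\<forall>M\<in>set Ms. square_mat M \<and> dim_row M \<le> d)"
proof -
  \<comment> \<open>Keys of both bases are collected: a key present on one side only would give a
    non-square block, which the count below excludes.\<close>
  define P where "P = \<kappa> ` B \<union> \<kappa>' ` B'"
  define C where "C p = {b \<in> B. \<kappa> b = p}" for p
  define R where "R p = {b' \<in> B'. \<kappa>' b' = p}" for p
  have finP: "finite P" using fin by (simp add: P_def)
  have finC: "finite (C p)" and finR: "finite (R p)" for p
    using fin by (simp_all add: C_def R_def)
  have le: "card (C p) \<le> card (R p)" for p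
  proof -
    \<comment> \<open>Nonzero coefficients join equal keys only, so the expansion of a vector with
      key \<open>p\<close> stays among the vectors of \<open>B'\<close> with key
      \<open>p\<close>.\<close>
    have "C p \<subseteq> cfun.span (R p)"
    proof
      fix b assume b: "b \<in> C p"
      then have "b \<in> cfun.span B'"
        using cfun.span_superset[of B] span by (auto simp: C_def)
      then have "b = (\<Sum>b'\<in>B'. cscale (cfun.representation B' b b') b')"
        using cfun.sum_representation_eq[OF ind(2) _ fin(2)] by simp
      also have "\<dots> = (\<Sum>b'\<in>R p. cscale (cfun.representation B' b b') b')"
      proof (rule sum.mono_neutral_right[OF fin(2)])
        show "\<forall>b'\<in>B' - R p. cscale (cfun.representation B' b b') b' = 0"
          using rep b by (fastforce simp: C_def R_def cscale_def fun_eq_iff)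
      qed (auto simp: R_def)
      also have "\<dots> \<in> cfun.span (R p)"
        by (intro cfun.span_sum cfun.span_scale cfun.span_base)
      finally show "b \<in> cfun.span (R p)" .
    qed
    moreover have "cfun.independent (C p)"
      using ind(1) by (rule cfun.independent_mono) (auto simp: C_def)
    ultimately show ?thesis
      using cfun.independent_span_bound[OF finR] by blast
  qed
  have "(\<Sum>p\<in>P. card (C p)) = card (\<Union>p\<in>P. C p)"
    by (rule card_UN_disjoint[symmetric]) (auto simp: finP finC, auto simp: C_def)
  also have "(\<Union>p\<in>P. C p) = B" by (auto simp: P_def C_def)
  also have "card B = card B'"
    using ind span by (metis cfun.dim_eq_card)
  also have "B' = (\<Union>p\<in>P. R p)" by (auto simp: P_def R_def)
  also have "card \<dots> = (\<Sum>p\<in>P. card (R p))"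
    by (rule card_UN_disjoint) (auto simp: finP finR, auto simp: R_def)
  \<comment> \<open>Termwise inequalities between finite sums with equal totals are
    equalities.\<close>
  finally have eq: "card (C p) = card (R p)" if "p \<in> P" for p
    using sum_mono_inv[of "\<lambda>p. card (C p)" P "\<lambda>p. card (R p)"] le that finP by blast
  obtain ps where ps: "set ps = P" "distinct ps"
    using finite_distinct_list[OF finP] by auto
  obtain L where L: "\<And>p. set (L p) = C p" "\<And>p. distinct (L p)"
    using finite_distinct_list[OF finC] by metis
  obtain L' where L': "\<And>p. set (L' p) = R p" "\<And>p. distinct (L' p)"
    using finite_distinct_list[OF finR] by metis
  define bs where "bs = concat (map L ps)"
  define bs' where "bs' = concat (map L' ps)"
  define Ms where "Ms = map (\<lambda>p. mat (length (L' p)) (length (L p))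
      (\<lambda>(i, j). cfun.representation B' (L p ! j) (L' p ! i))) ps"
  have "set bs = B" "set bs' = B'"
    by (auto simp: bs_def bs'_def L L' ps P_def C_def R_def)
  moreover have "distinct bs" "distinct bs'"
    unfolding bs_def bs'_def
    by (rule distinct_concat_map; auto simp: L L' ps C_def R_def)+
  moreover have "change_of_basis_mat bs bs' = diag_block_mat Ms"
    unfolding change_of_basis_mat_def \<open>set bs' = B'\<close> unfolding bs_def bs'_def Ms_def
    by (rule mat_concat_eq_diag_block_mat[where g = "\<lambda>x y. cfun.representation B' y x"])
      (use rep ps in \<open>auto simp: L L' C_def R_def, metis\<close>)
  moreover have "square_mat M \<and> dim_row M \<le> d" if M: "M \<in> set Ms" for M
  proof -
    obtain p where p: "p \<in> P" "dim_row M = length (L' p)" "dim_col M = length (L p)"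
      using M by (auto simp: Ms_def ps)
    have "length (L' p) = card (R p)" "length (L p) = card (C p)"
      using L L' by (metis distinct_card)+
    then show ?thesis using p eq card by (simp add: R_def)
  qed
  ultimately show ?thesis by blast
qed

section \<open>The action on functions and the sum of transpositions\<close>

lemma fun_act_apply:
  assumes "bij \<sigma>"
  shows "fun_act \<sigma> f w = f (permute_list \<sigma> w)"
  using assms by (simp add: fun_act_def word_act_def inv_inv_eq)

lemma fun_act_sum: "fun_act \<sigma> (\<Sum>a\<in>A. f a) = (\<Sum>a\<in>A. fun_act \<sigma> (f a))"
  by (auto simp: fun_act_def sum_fun_apply)

lemma fun_act_cscale: "fun_act \<sigma> (cscale c f) = cscale c (fun_act \<sigma> f)"
  by (auto simp: fun_act_def cscale_def)

lemma fun_act_delta: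
  assumes "\<sigma> permutes {..<length s}"
  shows "fun_act \<sigma> (delta s) = delta (permute_list (Hilbert_Choice.inv \<sigma>) s)"
proof
  fix w
  have inv: "Hilbert_Choice.inv \<sigma> permutes {..<length s}"
    using assms by (rule permutes_inv)
  have "permute_list \<sigma> w = s \<longleftrightarrow> w = permute_list (Hilbert_Choice.inv \<sigma>) s"
  proof
    assume "permute_list \<sigma> w = s"
    \<comment> \<open>\<open>\<sigma>\<close> is known to permute the positions of \<open>s\<close>
      only, so \<open>w\<close> must first be seen to have the same length.\<close>
    moreover from this have "length w = length s" by auto
    ultimately show "w = permute_list (Hilbert_Choice.inv \<sigma>) s"
      using permute_list_compose[of "Hilbert_Choice.inv \<sigma>" w \<sigma>] inv permutes_inv_o(1)[OF assms]
      by simp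
  next
    assume "w = permute_list (Hilbert_Choice.inv \<sigma>) s"
    then show "permute_list \<sigma> w = s"
      using permute_list_compose[of \<sigma> s "Hilbert_Choice.inv \<sigma>"] assms permutes_inv_o(2)[OF assms]
      by simp
  qed
  then show "fun_act \<sigma> (delta s) w = delta (permute_list (Hilbert_Choice.inv \<sigma>) s) w"
    by (simp add: fun_act_apply permutes_bij[OF assms] delta_def)
qed

text \<open>The pairs are ordered, and each of the $m$ pairs with \<open>x = y\<close> contributes the identity.\<close>

definition transposition_sum :: "nat \<Rightarrow> (nat list \<Rightarrow> complex) \<Rightarrow> nat list \<Rightarrow> complex" where
  "transposition_sum m f = (\<Sum>x<m. \<Sum>y<m. fun_act (Transposition.transpose x y) f)"

lemma transposition_sum_apply:
  "transposition_sum m f w = (\<Sum>x<m. \<Sum>y<m. f (permute_list (Transposition.transpose x y) w))"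
  by (simp add: transposition_sum_def sum_fun_apply fun_act_apply)

text \<open>Lets an eigenvalue equation pass from generators to their span, both for Specht modules
  and for isotypic components.\<close>

lemma subspace_transposition_sum_eigenspace:
  "cfun.subspace {f. transposition_sum m f = cscale c f}"
  by (auto simp: cfun.subspace_def fun_eq_iff transposition_sum_apply cscale_def sum.distrib
    distrib_left sum_distrib_left[symmetric])

section \<open>Column antisymmetrizers and the scalar on the Specht module\<close>

lemma permute_list_tabloid:
  assumes "\<sigma> permutes {..<sum_list \<mu>}"
  shows "permute_list \<sigma> (tabloid \<mu> s) = tabloid \<mu> (s \<circ> \<sigma>)"
  using permutes_in_image[OF assms] by (auto simp: permute_list_def tabloid_def)

text \<open>The column antisymmetrizer of \<open>t\<close> applied to the tabloid of an arbitrary map \<open>s\<close>.\<close>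

definition column_sum ::
    "nat list \<Rightarrow> (nat \<Rightarrow> nat \<times> nat) \<Rightarrow> (nat \<Rightarrow> nat \<times> nat) \<Rightarrow> nat list \<Rightarrow> complex" where
  "column_sum \<mu> t s =
    (\<Sum>\<pi>\<in>column_stabilizer \<mu> t.
      cscale (of_int (sign \<pi>)) (delta (tabloid \<mu> (s \<circ> Hilbert_Choice.inv \<pi>))))"

lemma polytabloid_eq_column_sum: "polytabloid \<mu> t = column_sum \<mu> t t"
  by (simp add: polytabloid_def column_sum_def)

lemma column_stabilizer_comp:
  assumes "\<pi> \<in> column_stabilizer \<mu> t" "\<rho> \<in> column_stabilizer \<mu> t"
  shows "\<pi> \<circ> \<rho> \<in> column_stabilizer \<mu> t"
  using assms permutes_in_image[of \<rho> "{..<sum_list \<mu>}"]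
  by (auto simp: column_stabilizer_def intro: permutes_compose)

lemma column_stabilizer_inv:
  assumes "\<pi> \<in> column_stabilizer \<mu> t"
  shows "Hilbert_Choice.inv \<pi> \<in> column_stabilizer \<mu> t"
proof -
  have p: "\<pi> permutes {..<sum_list \<mu>}" using assms by (simp add: column_stabilizer_def)
  have "snd (t (Hilbert_Choice.inv \<pi> j)) = snd (t j)" if "j < sum_list \<mu>" for j
  proof -
    have "Hilbert_Choice.inv \<pi> j < sum_list \<mu>"
      using permutes_in_image[OF permutes_inv[OF p], of j] that by simp
    then show ?thesis
      using assms permutes_inverses(1)[OF p, of j] unfolding column_stabilizer_def by force
  qed
  then show ?thesis using permutes_inv[OF p] by (simp add: column_stabilizer_def)
qed

text \<open>A tabloid sees rows only, and column permutations map the entries among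
  themselves.\<close>

lemma column_sum_cong:
  assumes "\<And>j. j < sum_list \<mu> \<Longrightarrow> fst (s j) = fst (s' j)"
  shows "column_sum \<mu> t s = column_sum \<mu> t s'"
proof -
  have "tabloid \<mu> (s \<circ> Hilbert_Choice.inv \<pi>) = tabloid \<mu> (s' \<circ> Hilbert_Choice.inv \<pi>)"
    if "\<pi> \<in> column_stabilizer \<mu> t" for \<pi>
  proof -
    have p: "Hilbert_Choice.inv \<pi> permutes {..<sum_list \<mu>}"
      using that by (auto simp: column_stabilizer_def intro: permutes_inv)
    show ?thesis
      using permutes_in_image[OF p] assms by (auto simp: tabloid_def)
  qed
  then show ?thesis by (simp add: column_sum_def)
qed

text \<open>Reindexing by \<open>\<pi> \<circ> Hilbert_Choice.inv \<rho>\<close> absorbs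
  \<open>\<rho>\<close> at the cost of its sign. With \<open>column_sum_cong\<close> this yields
  cancellation: an odd \<open>\<rho>\<close> that preserves the rows of \<open>s\<close> forces the
  sum to vanish.\<close>

lemma column_sum_comp:
  assumes \<rho>: "\<rho> \<in> column_stabilizer \<mu> t"
  shows "column_sum \<mu> t (s \<circ> \<rho>) = cscale (of_int (sign \<rho>)) (column_sum \<mu> t s)"
proof -
  have r: "\<rho> permutes {..<sum_list \<mu>}" using \<rho> by (simp add: column_stabilizer_def)
  have "column_sum \<mu> t (s \<circ> \<rho>) =
    (\<Sum>\<pi>\<in>column_stabilizer \<mu> t. cscale (of_int (sign \<rho> * sign \<pi>))
      (delta (tabloid \<mu> (s \<circ> Hilbert_Choice.inv \<pi>))))"
    unfolding column_sum_def
  proof (rule sum.reindex_bij_witness[where i = "\<lambda>\<pi>. \<pi> \<circ> \<rho>"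
        and j = "\<lambda>\<pi>. \<pi> \<circ> Hilbert_Choice.inv \<rho>"])
    fix \<pi> assume \<pi>: "\<pi> \<in> column_stabilizer \<mu> t"
    then have p: "\<pi> permutes {..<sum_list \<mu>}" by (simp add: column_stabilizer_def)
    show "(\<pi> \<circ> Hilbert_Choice.inv \<rho>) \<circ> \<rho> = \<pi>"
      using permutes_inv_o[OF r] by (simp add: comp_assoc)
    show "(\<pi> \<circ> \<rho>) \<circ> Hilbert_Choice.inv \<rho> = \<pi>"
      using permutes_inv_o[OF r] by (simp add: comp_assoc)
    show "\<pi> \<circ> Hilbert_Choice.inv \<rho> \<in> column_stabilizer \<mu> t" "\<pi> \<circ> \<rho> \<in> column_stabilizer \<mu> t"
      using \<pi> \<rho> by (auto intro: column_stabilizer_comp column_stabilizer_inv)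
    have "Hilbert_Choice.inv (\<pi> \<circ> Hilbert_Choice.inv \<rho>) = \<rho> \<circ> Hilbert_Choice.inv \<pi>"
      using p r by (simp add: o_inv_distrib permutes_bij bij_imp_bij_inv inv_inv_eq)
    moreover have "sign (\<pi> \<circ> Hilbert_Choice.inv \<rho>) = sign \<pi> * sign \<rho>"
      using p r by (metis sign_compose sign_inverse permutes_imp_permutation
        permutation_inverse finite_lessThan)
    ultimately show "cscale (of_int (sign \<rho> * sign (\<pi> \<circ> Hilbert_Choice.inv \<rho>)))
        (delta (tabloid \<mu> (s \<circ> Hilbert_Choice.inv (\<pi> \<circ> Hilbert_Choice.inv \<rho>)))) =
      cscale (of_int (sign \<pi>)) (delta (tabloid \<mu> (s \<circ> \<rho> \<circ> Hilbert_Choice.inv \<pi>)))"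
      by (simp add: sign_def comp_assoc)
  qed
  then show ?thesis
    by (simp add: column_sum_def cfun.scale_sum_right)
qed

text \<open>The transpositions are closed under conjugation, so their sum commutes with each column
  permutation; the swaps can be applied to \<open>t\<close> first and the antisymmetrization
  afterwards.\<close>

lemma transposition_sum_polytabloid:
  "transposition_sum (sum_list \<mu>) (polytabloid \<mu> t) =
    (\<Sum>x<sum_list \<mu>. \<Sum>y<sum_list \<mu>. column_sum \<mu> t (t \<circ> Transposition.transpose x y))"
proof -
  let ?m = "sum_list \<mu>"
  let ?D = "\<lambda>s. delta (tabloid \<mu> s)"
  have act: "fun_act (Transposition.transpose x y) (?D s) = ?D (s \<circ> Transposition.transpose x y)"
    if "x < ?m" "y < ?m" for x y s
  proof -
    have p: "Transposition.transpose x y permutes {..<?m}"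
      using that by (simp add: permutes_swap_id)
    moreover have "length (tabloid \<mu> s) = ?m" by (simp add: tabloid_def)
    ultimately show ?thesis
      by (simp add: fun_act_delta permute_list_tabloid)
  qed
  have conj: "(\<Sum>x<?m. \<Sum>y<?m. ?D (t \<circ> Hilbert_Choice.inv \<pi> \<circ> Transposition.transpose x y)) =
      (\<Sum>x<?m. \<Sum>y<?m. ?D (t \<circ> Transposition.transpose x y \<circ> Hilbert_Choice.inv \<pi>))"
    if "\<pi> \<in> column_stabilizer \<mu> t" for \<pi>
  proof -
    let ?p = "Hilbert_Choice.inv \<pi>"
    have p: "?p permutes {..<?m}"
      using that by (auto simp: column_stabilizer_def intro: permutes_inv)
    \<comment> \<open>Conjugating a transposition relabels its two entries; the relabelling is then
      undone by reindexing the sums over \<open>y\<close> and \<open>x\<close>.\<close>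
    have "?p \<circ> Transposition.transpose x y = Transposition.transpose (?p x) (?p y) \<circ> ?p" for x y
      using permutes_inj[OF p] by (auto simp: Transposition.transpose_def fun_eq_iff dest: injD)
    then have "(\<Sum>x<?m. \<Sum>y<?m. ?D (t \<circ> ?p \<circ> Transposition.transpose x y)) =
      (\<Sum>x<?m. \<Sum>y<?m. ?D (t \<circ> Transposition.transpose (?p x) (?p y) \<circ> ?p))"
      by (simp add: comp_assoc)
    also have "\<dots> = (\<Sum>x<?m. \<Sum>y<?m. ?D (t \<circ> Transposition.transpose (?p x) y \<circ> ?p))"
      using sum.permute[OF p, of "\<lambda>y. ?D (t \<circ> Transposition.transpose (?p x) y \<circ> ?p)" for x]
      by (simp add: o_def)
    also have "\<dots> = (\<Sum>x<?m. \<Sum>y<?m. ?D (t \<circ> Transposition.transpose x y \<circ> ?p))"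
      using sum.permute[OF p, of "\<lambda>x. \<Sum>y<?m. ?D (t \<circ> Transposition.transpose x y \<circ> ?p)"]
      by (simp add: o_def)
    finally show ?thesis .
  qed
  have "transposition_sum ?m (polytabloid \<mu> t) =
    (\<Sum>x<?m. \<Sum>y<?m. \<Sum>\<pi>\<in>column_stabilizer \<mu> t. cscale (of_int (sign \<pi>))
      (?D (t \<circ> Hilbert_Choice.inv \<pi> \<circ> Transposition.transpose x y)))"
    by (simp add: transposition_sum_def polytabloid_def fun_act_sum fun_act_cscale act)
  also have "\<dots> = (\<Sum>\<pi>\<in>column_stabilizer \<mu> t. cscale (of_int (sign \<pi>))
      (\<Sum>x<?m. \<Sum>y<?m. ?D (t \<circ> Hilbert_Choice.inv \<pi> \<circ> Transposition.transpose x y)))"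
    unfolding cfun.scale_sum_right
    by (rule sum_rotate3)
  also have "\<dots> = (\<Sum>\<pi>\<in>column_stabilizer \<mu> t. cscale (of_int (sign \<pi>))
      (\<Sum>x<?m. \<Sum>y<?m. ?D (t \<circ> Transposition.transpose x y \<circ> Hilbert_Choice.inv \<pi>)))"
    using conj by simp
  also have "\<dots> = (\<Sum>x<?m. \<Sum>y<?m. column_sum \<mu> t (t \<circ> Transposition.transpose x y))"
    unfolding cfun.scale_sum_right column_sum_def
    by (rule sum_rotate3[symmetric])
  finally show ?thesis .
qed

text \<open>The factor by which a swap of the entries in boxes \<open>p\<close> and \<open>q\<close>
  acts under the column antisymmetrizer. The row test comes first, so a pair with
  \<open>p = q\<close> counts 1, as the identity should.\<close>

definition pair_weight :: "nat \<times> nat \<Rightarrow> nat \<times> nat \<Rightarrow> int" where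
  "pair_weight p q = (if fst p = fst q then 1 else if snd p = snd q then - 1 else 0)"

text \<open>For a Young diagram this is twice the content sum plus the number of boxes.\<close>

definition diagram_weight :: "nat list \<Rightarrow> int" where
  "diagram_weight \<mu> = (\<Sum>p\<in>boxes \<mu>. \<Sum>q\<in>boxes \<mu>. pair_weight p q)"

text \<open>If \<open>x\<close> and \<open>y\<close> share neither row nor column, with \<open>x\<close> in the higher row, let \<open>z\<close> be the
  entry in the row of \<open>x\<close> and the column of \<open>y\<close>. After the swap \<open>y\<close> and \<open>z\<close> lie in the same row,
  so antisymmetrizing over their common column gives zero.\<close>

lemma column_sum_transpose:
  assumes sorted: "sorted_wrt (\<ge>) \<mu>" and t: "tableau \<mu> t"
    and xy: "x < sum_list \<mu>" "y < sum_list \<mu>"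
  shows "column_sum \<mu> t (t \<circ> Transposition.transpose x y) =
    cscale (of_int (pair_weight (t x) (t y))) (polytabloid \<mu> t)"
proof -
  have bij: "bij_betw t {..<sum_list \<mu>} (boxes \<mu>)" using t by (simp add: tableau_def)
  have transp: "Transposition.transpose a b \<in> column_stabilizer \<mu> t"
    if "a < sum_list \<mu>" "b < sum_list \<mu>" "snd (t a) = snd (t b)" for a b
    using that by (auto simp: column_stabilizer_def Transposition.transpose_def
      intro: permutes_swap_id)
  have vanish: "column_sum \<mu> t (t \<circ> Transposition.transpose x y) = 0"
    if x: "x < sum_list \<mu>" and y: "y < sum_list \<mu>"
      and other: "fst (t x) < fst (t y)" "snd (t x) \<noteq> snd (t y)" for x y
  proof -
    have "t y \<in> boxes \<mu>" using bij y by (auto simp: bij_betw_def)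
    then have "fst (t y) < length \<mu>" "snd (t y) < \<mu> ! fst (t y)"
      by (auto simp: boxes_def)
    \<comment> \<open>Rows do not get longer downwards, so the higher row of \<open>x\<close>
      reaches the column of \<open>y\<close>; this is why the entry \<open>z\<close> exists.\<close>
    moreover have "\<mu> ! fst (t y) \<le> \<mu> ! fst (t x)"
      using sorted_wrt_nth_less[OF sorted other(1)] \<open>fst (t y) < length \<mu>\<close> by simp
    ultimately have "(fst (t x), snd (t y)) \<in> boxes \<mu>"
      using other(1) by (auto simp: boxes_def)
    then obtain z where z: "z < sum_list \<mu>" "t z = (fst (t x), snd (t y))"
      using bij unfolding bij_betw_def by (metis imageE lessThan_iff)
    have ne: "z \<noteq> x" "z \<noteq> y"
      using z(2) other by (metis snd_conv, metis fst_conv less_irrefl)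
    let ?s = "t \<circ> Transposition.transpose x y"
    have "column_sum \<mu> t ?s = column_sum \<mu> t (?s \<circ> Transposition.transpose y z)"
      using z ne other by (intro column_sum_cong) (auto simp: Transposition.transpose_def)
    also have "\<dots> = cscale (- 1) (column_sum \<mu> t ?s)"
      using column_sum_comp[OF transp[OF y z(1)], of ?s] z ne
      by (simp add: sign_swap_id)
    finally show ?thesis
      by (auto simp: fun_eq_iff cscale_def)
  qed
  consider (row) "fst (t x) = fst (t y)"
    | (column) "fst (t x) \<noteq> fst (t y)" "snd (t x) = snd (t y)"
    | (other) "fst (t x) \<noteq> fst (t y)" "snd (t x) \<noteq> snd (t y)"
    by blast
  then show ?thesis
  proof cases
    case row
    then have "column_sum \<mu> t (t \<circ> Transposition.transpose x y) = column_sum \<mu> t t"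
      by (intro column_sum_cong) (auto simp: Transposition.transpose_def)
    with row show ?thesis
      by (simp add: pair_weight_def polytabloid_eq_column_sum)
  next
    case column
    then have "x \<noteq> y" by auto
    with column show ?thesis
      using column_sum_comp[OF transp[OF xy], of t]
      by (simp add: pair_weight_def polytabloid_eq_column_sum sign_swap_id)
  next
    case other
    have "column_sum \<mu> t (t \<circ> Transposition.transpose x y) = 0"
    proof (cases "fst (t x) < fst (t y)")
      case True
      then show ?thesis using vanish[of x y] xy other by simp
    next
      case False
      then show ?thesis
        using vanish[of y x] xy other by (simp add: transpose_commute[of x y])
    qed
    then show ?thesis
      using other by (auto simp: pair_weight_def cscale_def fun_eq_iff)
  qed
qed

text \<open>Each swap multiplies a polytabloid by its pair weight, and a tableau is a bijection onto
  the boxes, so the total factor is the same for all tableaux.\<close>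

lemma transposition_sum_specht:
  assumes "young_diagram m \<mu>" and "f \<in> specht \<mu>"
  shows "transposition_sum m f = cscale (of_int (diagram_weight \<mu>)) f"
proof -
  have m: "sum_list \<mu> = m" and sorted: "sorted_wrt (\<ge>) \<mu>"
    using assms(1) by (auto simp: young_diagram_def)
  have "transposition_sum m f = cscale (of_int (diagram_weight \<mu>)) f"
    if t: "tableau \<mu> t" and f: "f = polytabloid \<mu> t" for f t
  proof -
    have bij: "bij_betw t {..<m} (boxes \<mu>)" using t m by (simp add: tableau_def)
    have "transposition_sum m f =
      (\<Sum>x<m. \<Sum>y<m. cscale (of_int (pair_weight (t x) (t y))) f)"
      using transposition_sum_polytabloid[of \<mu> t] column_sum_transpose[OF sorted t]
      by (simp add: m f)
    also have "\<dots> = cscale (\<Sum>x<m. \<Sum>y<m. of_int (pair_weight (t x) (t y))) f"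
      by (simp add: cfun.scale_sum_left)
    also have "(\<Sum>x<m. \<Sum>y<m. pair_weight (t x) (t y)) = diagram_weight \<mu>"
      unfolding diagram_weight_def
      by (subst sum.reindex_bij_betw[OF bij, symmetric],
          subst sum.reindex_bij_betw[OF bij, symmetric]) simp
    then have "(\<Sum>x<m. \<Sum>y<m. of_int (pair_weight (t x) (t y)) :: complex) =
        of_int (diagram_weight \<mu>)"
      by (simp flip: of_int_sum)
    finally show ?thesis .
  qed
  then have "{polytabloid \<mu> t |t. tableau \<mu> t} \<subseteq>
      {f. transposition_sum m f = cscale (of_int (diagram_weight \<mu>)) f}"
    by blast
  then have "specht \<mu> \<subseteq> {f. transposition_sum m f = cscale (of_int (diagram_weight \<mu>)) f}"
    unfolding specht_def by (rule cfun.span_minimal[OF _ subspace_transposition_sum_eigenspace])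
  with assms(2) show ?thesis by blast
qed

section \<open>Isotypic components and their orthogonality\<close>

lemma transposition_sum_rep_iso:
  assumes \<mu>: "young_diagram m \<mu>" and U: "submodule m U" and iso: "rep_iso m U (specht \<mu>)"
    and u: "u \<in> U"
  shows "transposition_sum m u = cscale (of_int (diagram_weight \<mu>)) u"
proof -
  obtain \<phi> where lin: "Vector_Spaces.linear cscale cscale \<phi>" and bij: "bij_betw \<phi> U (specht \<mu>)"
    and equiv: "\<And>\<sigma> u. \<sigma> permutes {..<m} \<Longrightarrow> u \<in> U \<Longrightarrow> \<phi> (fun_act \<sigma> u) = fun_act \<sigma> (\<phi> u)"
    using iso by (auto simp: rep_iso_def)
  interpret \<phi>: module_hom cscale cscale \<phi>
    using lin by (simp add: Vector_Spaces.linear_def)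
  have sub: "cfun.subspace U" and act: "\<And>\<sigma>. \<sigma> permutes {..<m} \<Longrightarrow> fun_act \<sigma> u \<in> U"
    using U u by (auto simp: submodule_def)
  \<comment> \<open>\<open>\<phi>\<close> is injective on \<open>U\<close> only, so both sides must
    lie in \<open>U\<close> before their images are compared.\<close>
  have "transposition_sum m u \<in> U"
    unfolding transposition_sum_def
    by (intro cfun.subspace_sum[OF sub] act permutes_swap_id) auto
  moreover have "cscale (of_int (diagram_weight \<mu>)) u \<in> U"
    using sub u by (rule cfun.subspace_scale)
  moreover have "\<phi> (transposition_sum m u) = \<phi> (cscale (of_int (diagram_weight \<mu>)) u)"
  proof -
    \<comment> \<open>An equivariant linear map commutes with a sum of group elements, which carries
      the question over to the Specht module.\<close>
    have "\<phi> (transposition_sum m u) = transposition_sum m (\<phi> u)"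
      using equiv[OF permutes_swap_id u] by (simp add: transposition_sum_def \<phi>.sum)
    also have "\<dots> = cscale (of_int (diagram_weight \<mu>)) (\<phi> u)"
      using bij u by (intro transposition_sum_specht[OF \<mu>]) (auto simp: bij_betw_def)
    finally show ?thesis by (simp add: \<phi>.scale)
  qed
  ultimately show ?thesis
    using bij by (auto simp: bij_betw_def dest: inj_onD)
qed

lemma transposition_sum_isotypic:
  assumes "young_diagram m \<mu>" and "f \<in> isotypic n k m \<mu>"
  shows "transposition_sum m f = cscale (of_int (diagram_weight \<mu>)) f"
proof -
  have "isotypic n k m \<mu> \<subseteq> {f. transposition_sum m f = cscale (of_int (diagram_weight \<mu>)) f}"
    unfolding isotypic_def
    by (rule cfun.span_minimal[OF _ subspace_transposition_sum_eigenspace])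
      (use transposition_sum_rep_iso[OF assms(1)] in blast)
  with assms(2) show ?thesis by blast
qed

lemma permute_list_words:
  assumes "\<sigma> permutes {..<n}" and "w \<in> words n k"
  shows "permute_list \<sigma> w \<in> words n k"
  using assms mset_permute_list[of \<sigma> w]
  by (auto simp: words_def set_permute_list count_mset[symmetric] simp del: count_mset)

lemma cinner_cscale_left: "cinner n k (cscale c f) g = c * cinner n k f g"
  by (simp add: cinner_def cscale_def sum_distrib_left mult_ac)

lemma cinner_cscale_right: "cinner n k f (cscale c g) = cnj c * cinner n k f g"
  by (simp add: cinner_def cscale_def sum_distrib_left mult_ac)

text \<open>Each transposition permutes the words and is its own inverse, so the sum is
  self-adjoint; \<open>m \<le> n\<close> keeps the swapped positions inside the words.\<close>

lemma cinner_transposition_sum: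
  assumes "m \<le> n"
  shows "cinner n k (transposition_sum m f) g = cinner n k f (transposition_sum m g)"
proof -
  let ?p = "\<lambda>x y. permute_list (Transposition.transpose x y)"
  have swap: "(\<Sum>w\<in>words n k. f (?p x y w) * cnj (g w)) =
      (\<Sum>w\<in>words n k. f w * cnj (g (?p x y w)))" if "x < m" "y < m" for x y
  proof (rule sum.reindex_bij_witness[where i = "?p x y" and j = "?p x y"])
    fix w assume w: "w \<in> words n k"
    have p: "Transposition.transpose x y permutes {..<n}"
      using that assms by (simp add: permutes_swap_id)
    show "?p x y w \<in> words n k" "?p x y w \<in> words n k"
      using permute_list_words[OF p w] by simp_all
    have "length w = n" using w by (simp add: words_def)
    then show "?p x y (?p x y w) = w" "?p x y (?p x y w) = w"
      "f (?p x y w) * cnj (g (?p x y (?p x y w))) = f (?p x y w) * cnj (g w)"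
      using p permute_list_compose[of "Transposition.transpose x y" w "Transposition.transpose x y"]
      by simp_all
  qed
  have "cinner n k (transposition_sum m f) g =
      (\<Sum>w\<in>words n k. \<Sum>x<m. \<Sum>y<m. f (?p x y w) * cnj (g w))"
    by (simp add: cinner_def transposition_sum_apply sum_distrib_right)
  also have "\<dots> = (\<Sum>x<m. \<Sum>y<m. \<Sum>w\<in>words n k. f (?p x y w) * cnj (g w))"
    by (rule sum_rotate3[symmetric])
  also have "\<dots> = (\<Sum>x<m. \<Sum>y<m. \<Sum>w\<in>words n k. f w * cnj (g (?p x y w)))"
    using swap by simp
  also have "\<dots> = (\<Sum>w\<in>words n k. \<Sum>x<m. \<Sum>y<m. f w * cnj (g (?p x y w)))"
    by (rule sum_rotate3)
  also have "\<dots> = cinner n k f (transposition_sum m g)"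
    by (simp add: cinner_def transposition_sum_apply sum_distrib_left)
  finally show ?thesis .
qed

text \<open>Eigenvectors of a self-adjoint operator for distinct eigenvalues; these are integers, so
  conjugation in the second argument leaves them unchanged.\<close>

lemma isotypic_orthogonal:
  assumes "m \<le> n" and "young_diagram m \<mu>" "f \<in> isotypic n k m \<mu>"
    and "young_diagram m \<nu>" "g \<in> isotypic n k m \<nu>"
    and "diagram_weight \<mu> \<noteq> diagram_weight \<nu>"
  shows "cinner n k f g = 0"
proof -
  have "of_int (diagram_weight \<mu>) * cinner n k f g = of_int (diagram_weight \<nu>) * cinner n k f g"
    using cinner_transposition_sum[OF assms(1), of k f g]
      transposition_sum_isotypic[OF assms(2,3)] transposition_sum_isotypic[OF assms(4,5)]
    by (simp add: cinner_cscale_left cinner_cscale_right)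
  with assms(6) show ?thesis by simp
qed

section \<open>Weights of diagrams with at most two rows\<close>

lemma diagram_weight_single: "diagram_weight [p] = int p ^ 2"
proof -
  have b: "boxes [p] = Pair 0 ` {..<p}" by (auto simp: boxes_def)
  show ?thesis
    by (simp add: diagram_weight_def b sum.reindex inj_on_def pair_weight_def power2_eq_square)
qed

text \<open>The rows contribute the squares; each of the \<open>q\<close> columns of height two
  contributes -1 for either order of its boxes.\<close>

lemma diagram_weight_pair:
  assumes "q \<le> p"
  shows "diagram_weight [p, q] = int p ^ 2 + int q ^ 2 - 2 * int q"
proof -
  have b: "boxes [p, q] = Pair 0 ` {..<p} \<union> Pair 1 ` {..<q}"
    by (auto simp: boxes_def nth_Cons split: nat.splits)
  have sum_boxes: "(\<Sum>b\<in>boxes [p, q]. h b) = (\<Sum>c<p. h (0, c)) + (\<Sum>c<q. h (1, c))"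
    for h :: "nat \<times> nat \<Rightarrow> int"
    unfolding b by (subst sum.union_disjoint) (auto simp: sum.reindex inj_on_def)
  have "(\<Sum>b\<in>boxes [p, q]. pair_weight (0, c) b) = int p - (if c < q then 1 else 0)" for c
    unfolding sum_boxes by (simp add: pair_weight_def)
  moreover have "(\<Sum>b\<in>boxes [p, q]. pair_weight (1, c) b) = int q - 1" if "c < q" for c
    unfolding sum_boxes using that assms by (simp add: pair_weight_def)
  ultimately have "diagram_weight [p, q] =
      (\<Sum>c<p. int p - (if c < q then 1 else 0)) + (\<Sum>c<q. int q - 1)"
    by (simp add: diagram_weight_def sum_boxes[of "\<lambda>b. \<Sum>b'\<in>boxes [p, q]. pair_weight b b'"])
  also have "(\<Sum>c<p. int p - (if c < q then 1 else 0)) = int p * int p - int q"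
  proof -
    have "{..<p} \<inter> {c. c < q} = {..<q}" using assms by auto
    then show ?thesis by (simp add: sum_subtractf sum.If_cases)
  qed
  finally show ?thesis by (simp add: power2_eq_square algebra_simps)
qed

text \<open>Brings diagrams with zero, one or two rows under a single formula in the second row
  length \<open>a\<close>, with \<open>a = 0\<close> in the first two cases.\<close>

lemma young_diagram_two_rows:
  assumes "young_diagram m \<mu>" "length \<mu> \<le> 2"
  obtains a where "2 * a \<le> m" "\<mu> = two_rows m a"
    "diagram_weight \<mu> = (int m - int a) ^ 2 + int a ^ 2 - 2 * int a"
proof -
  consider "\<mu> = []" | p where "\<mu> = [p]" | p q where "\<mu> = [p, q]"
    using assms(2) by (cases \<mu>; cases "tl \<mu>") auto
  then show thesis
  proof cases
    case 1
    then show thesis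
      using assms by (intro that[of 0])
        (auto simp: young_diagram_def two_rows_def diagram_weight_def boxes_def)
  next
    case 2
    then show thesis
      using assms by (intro that[of 0])
        (auto simp: young_diagram_def two_rows_def diagram_weight_single)
  next
    case (3 p q)
    then show thesis
      using assms by (intro that[of q])
        (auto simp: young_diagram_def two_rows_def diagram_weight_pair)
  qed
qed

lemma diagram_weight_inj_two_rows:
  assumes "young_diagram m \<mu>" "length \<mu> \<le> 2" "young_diagram m \<nu>" "length \<nu> \<le> 2"
    and "diagram_weight \<mu> = diagram_weight \<nu>"
  shows "\<mu> = \<nu>"
proof -
  obtain a where a: "2 * a \<le> m" "\<mu> = two_rows m a"
    "diagram_weight \<mu> = (int m - int a) ^ 2 + int a ^ 2 - 2 * int a"
    using assms by (elim young_diagram_two_rows)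
  obtain b where b: "2 * b \<le> m" "\<nu> = two_rows m b"
    "diagram_weight \<nu> = (int m - int b) ^ 2 + int b ^ 2 - 2 * int b"
    using assms by (elim young_diagram_two_rows)
  \<comment> \<open>Half the difference of the two weights, factored. The second factor is positive
    because \<open>a + b \<le> m\<close>.\<close>
  have "(int b - int a) * (int m + 1 - int a - int b) = 0"
    using assms(5) unfolding a(3) b(3) by (simp add: power2_eq_square algebra_simps)
  with a(1) b(1) have "a = b" by auto
  with a b show ?thesis by simp
qed

section \<open>Orthogonality of the basis vectors and their coefficients\<close>

lemma basis_index_diagram:
  assumes "(ls, c) \<in> basis_index n k i" "j < i"
  shows "young_diagram (Suc j) (ls ! j)" "length (ls ! j) \<le> 2"
proof -
  have chain: "young_chain i ls" using assms by (auto simp: basis_index_def)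
  then show y: "young_diagram (Suc j) (ls ! j)"
    using assms(2) by (simp add: young_chain_def)
  \<comment> \<open>Diagrams grow along the chain, so the two-row bound on the last one, at position
    \<open>i - 1\<close>, is inherited by all earlier ones.\<close>
  have "boxes (ls ! j) \<subseteq> boxes (ls ! (i - 1))"
  proof (rule inc_induct[of j "i - 1"])
    fix l assume "l < i - 1" and sub: "boxes (ls ! Suc l) \<subseteq> boxes (ls ! (i - 1))"
    then have "add_box (ls ! l) (ls ! Suc l)" using chain by (auto simp: young_chain_def)
    with sub show "boxes (ls ! l) \<subseteq> boxes (ls ! (i - 1))" by (auto simp: add_box_def)
  qed (use assms(2) in auto)
  moreover have "length (ls ! (i - 1)) \<le> 2"
  proof -
    have "length ls = i" using chain by (simp add: young_chain_def)
    moreover have "ls \<noteq> []" using calculation assms(2) by auto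
    ultimately have "ls ! (i - 1) = last ls" by (simp add: last_conv_nth)
    moreover obtain a where "last ls = two_rows i a"
      using assms by (auto simp: basis_index_def)
    ultimately show ?thesis
      by (simp add: two_rows_def)
  qed
  \<comment> \<open>Rows are nonempty, so a third row would contain this box.\<close>
  ultimately have "(2, 0) \<notin> boxes (ls ! j)" by (auto simp: boxes_def)
  moreover have "ls ! j ! 2 \<noteq> 0" if "2 < length (ls ! j)"
    using y nth_mem[OF that] unfolding young_diagram_def by metis
  ultimately show "length (ls ! j) \<le> 2"
    by (force simp: boxes_def)
qed

lemma suffix_space_support:
  assumes "f \<in> suffix_space n k c" and "f w \<noteq> 0"
  shows "w \<in> words n k" "drop (n - length c) w = c"
proof -
  let ?S = "{f. \<forall>w. f w \<noteq> 0 \<longrightarrow> w \<in> words n k \<and> drop (n - length c) w = c}"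
  have "cfun.subspace ?S"
    unfolding cfun.subspace_def by (auto simp: cscale_def) (metis add.right_neutral)+
  then have "suffix_space n k c \<subseteq> ?S"
    unfolding suffix_space_def
    by (intro cfun.span_minimal) (auto simp: delta_def split: if_splits)
  with assms show "w \<in> words n k" "drop (n - length c) w = c" by auto
qed

text \<open>Two levels are allowed so that \<open>i' = i\<close> covers a single basis and
  \<open>i' = i - 1\<close> two consecutive ones. The data common to both vectors are the first
  \<open>i'\<close> diagrams and the last \<open>n - i\<close> letters: differing letters give
  disjoint supports, differing diagrams distinct isotypic components.\<close>

lemma basis_vectors_orthogonal:
  assumes idx: "(ls, c) \<in> basis_index n k i" "(ls', c') \<in> basis_index n k i'"
    and i: "i' \<le> i" "i \<le> n"
    and f: "f \<in> chain_space n k ls \<inter> suffix_space n k c"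
    and g: "g \<in> chain_space n k ls' \<inter> suffix_space n k c'"
    and ne: "(take i' ls, c) \<noteq> (ls', drop (i - i') c')"
  shows "cinner n k f g = 0"
proof (cases "c = drop (i - i') c'")
  case False
  have len: "length c = n - i" "length c' = n - i'"
    using idx by (auto simp: basis_index_def)
  have "f w * cnj (g w) = 0" for w
  proof (rule ccontr)
    assume "f w * cnj (g w) \<noteq> 0"
    then have "f w \<noteq> 0" "g w \<noteq> 0" by auto
    then have "drop (n - length c) w = c" "drop (n - length c') w = c'"
      using f g suffix_space_support by blast+
    then have "drop i w = c" "drop i' w = c'"
      using len i by auto
    then have "c = drop (i - i') c'"
      using i by auto
    with False show False by simp
  qed
  then show ?thesis unfolding cinner_def by (intro sum.neutral) blast
next
  case True
  have len: "length ls = i" "length ls' = i'"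
    using idx by (auto simp: basis_index_def young_chain_def)
  have "take i' ls \<noteq> ls'" using ne True by simp
  then obtain j where j: "j < i'" "ls ! j \<noteq> ls' ! j"
    using len i nth_equalityI[of "take i' ls" ls'] by auto
  then have "f \<in> isotypic n k (Suc j) (ls ! j)" "g \<in> isotypic n k (Suc j) (ls' ! j)"
    using f g len i by (auto simp: chain_space_def)
  moreover have "young_diagram (Suc j) (ls ! j)" "length (ls ! j) \<le> 2"
    using basis_index_diagram[OF idx(1)] j i by auto
  moreover have "young_diagram (Suc j) (ls' ! j)" "length (ls' ! j) \<le> 2"
    using basis_index_diagram[OF idx(2)] j i by auto
  ultimately show ?thesis
    using diagram_weight_inj_two_rows[of "Suc j" "ls ! j" "ls' ! j"] j i
    by (intro isotypic_orthogonal[of "Suc j" n "ls ! j" f k "ls' ! j" g]) auto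
qed

text \<open>Pairing the expansion of \<open>f\<close> with \<open>b\<close> leaves only the
  coefficient of \<open>b\<close>.\<close>

lemma representation_eq_cinner:
  assumes "cfun.independent B" "finite B" "f \<in> cfun.span B" "b \<in> B"
    and orth: "\<And>b'. b' \<in> B \<Longrightarrow> b' \<noteq> b \<Longrightarrow> cinner n k b' b = 0" and unit: "cinner n k b b = 1"
  shows "cfun.representation B f b = cinner n k f b"
proof -
  let ?r = "cfun.representation B f"
  have "cinner n k (\<Sum>b'\<in>B. cscale (?r b') b') b = (\<Sum>b'\<in>B. ?r b' * cinner n k b' b)"
    by (simp add: cinner_def sum_fun_apply cscale_def sum_distrib_left sum_distrib_right mult_ac)
      (rule sum.swap)
  also have "\<dots> = (\<Sum>b'\<in>B. if b' = b then ?r b' else 0)"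
    using orth unit by (intro sum.cong) auto
  also have "\<dots> = ?r b"
    using assms by simp
  also have "(\<Sum>b'\<in>B. cscale (?r b') b') = f"
    using cfun.sum_representation_eq[OF assms(1,3,2)] by simp
  finally show ?thesis by simp
qed

lemma finite_words: "finite (words n k)"
proof (rule finite_subset)
  show "words n k \<subseteq> {w. set w \<subseteq> {1, 2} \<and> length w = n}" by (auto simp: words_def)
qed (rule finite_lists_length_eq, simp)

text \<open>The deltas of the finitely many words span the function space, which bounds every
  independent set in it.\<close>

lemma intermediate_basis_finite:
  assumes "intermediate_basis n k i B"
  shows "finite B"
proof -
  have "B \<subseteq> cfun.span (delta ` words n k)"
  proof
    fix f assume "f \<in> B"
    then have f: "f \<in> fun_space n k"
      using assms cfun.span_superset[of B] by (auto simp: intermediate_basis_def)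
    have "f w = (\<Sum>v\<in>words n k. cscale (f v) (delta v)) w" for w
      using f finite_words
      by (simp add: sum_fun_apply cscale_def delta_def if_distrib[of "(*) _"] fun_space_def
        cong: if_cong)
    then have "f = (\<Sum>v\<in>words n k. cscale (f v) (delta v))" by blast
    also have "\<dots> \<in> cfun.span (delta ` words n k)"
      by (intro cfun.span_sum cfun.span_scale cfun.span_base imageI)
    finally show "f \<in> cfun.span (delta ` words n k)" .
  qed
  moreover have "cfun.independent B" using assms by (simp add: intermediate_basis_def)
  ultimately show ?thesis
    using cfun.independent_span_bound[OF finite_imageI[OF finite_words]] by blast
qed

section \<open>The blocks of the change of basis\<close>

theorem theorem4:
  fixes n k i :: nat and B B' :: "(nat list \<Rightarrow> complex) set"
  assumes "n \<ge> 1" and "k \<le> n" and "1 \<le> i" and "i \<le> n"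
    and "intermediate_basis n k i B"
    and "intermediate_basis n k (i - 1) B'"
  shows "\<exists>bs bs' Ms. distinct bs \<and> set bs = B \<and> distinct bs' \<and> set bs' = B' \<and>
    change_of_basis_mat bs bs' = diag_block_mat Ms \<and>
    (\<forall>M\<in>set Ms. square_mat M \<and> dim_row M \<le> 2)"
proof -
  let ?I = "basis_index n k i" and ?I' = "basis_index n k (i - 1)"
  obtain v where v: "bij_betw v ?I B"
    "\<And>ls c. (ls, c) \<in> ?I \<Longrightarrow> v (ls, c) \<in> chain_space n k ls \<inter> suffix_space n k c"
    using assms(5) by (fastforce simp: intermediate_basis_def)
  obtain v' where v': "bij_betw v' ?I' B'"
    "\<And>ls c. (ls, c) \<in> ?I' \<Longrightarrow> v' (ls, c) \<in> chain_space n k ls \<inter> suffix_space n k c"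
    "\<And>ls c. (ls, c) \<in> ?I' \<Longrightarrow> cinner n k (v' (ls, c)) (v' (ls, c)) = 1"
    using assms(6) by (fastforce simp: intermediate_basis_def)
  have span: "cfun.span B = fun_space n k" "cfun.span B' = fun_space n k"
    and ind: "cfun.independent B" "cfun.independent B'"
    using assms by (auto simp: intermediate_basis_def)
  have fin: "finite B" "finite B'"
    using assms intermediate_basis_finite by blast+
  \<comment> \<open>The keys record what neighbouring levels share: the last diagram is dropped from
    an index of \<open>B\<close>, the first suffix letter from an index of
    \<open>B'\<close>.\<close>
  define \<kappa> where "\<kappa> b = (let (ls, c) = the_inv_into ?I v b in (take (i - 1) ls, c))" for b
  define \<kappa>' where "\<kappa>' b = (let (ls, c) = the_inv_into ?I' v' b in (ls, tl c))" for b
  have \<kappa>: "\<kappa> (v (ls, c)) = (take (i - 1) ls, c)" if "(ls, c) \<in> ?I" for ls c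
    using that v(1) by (simp add: \<kappa>_def bij_betw_def the_inv_into_f_f)
  have \<kappa>': "\<kappa>' (v' (ls, c)) = (ls, tl c)" if "(ls, c) \<in> ?I'" for ls c
    using that v'(1) by (simp add: \<kappa>'_def bij_betw_def the_inv_into_f_f)
  have orth: "cinner n k b b' = 0" if bb': "b \<in> B'" "b' \<in> B'" "b \<noteq> b'" for b b'
  proof -
    obtain ls c where b: "(ls, c) \<in> ?I'" "b = v' (ls, c)"
      using bb' bij_betw_imp_surj_on[OF v'(1)] by (metis imageE surj_pair)
    obtain ls' c' where b': "(ls', c') \<in> ?I'" "b' = v' (ls', c')"
      using bb' bij_betw_imp_surj_on[OF v'(1)] by (metis imageE surj_pair)
    have "length ls = i - 1" using b by (auto simp: basis_index_def young_chain_def)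
    then show ?thesis
      using bb' b b' v'(2) assms(4)
      by (intro basis_vectors_orthogonal[OF b(1) b'(1)]) auto
  qed
  have unit: "cinner n k b b = 1" if "b \<in> B'" for b
    using that v'(1,3) by (auto simp: bij_betw_def)
  show ?thesis
  proof (rule change_of_basis_block_diagonal[of B B' \<kappa> \<kappa>' 2])
    fix b b' assume b: "b \<in> B" and b': "b' \<in> B'" and "cfun.representation B' b b' \<noteq> 0"
    moreover have "b \<in> cfun.span B'"
      using b cfun.span_superset[of B] span by auto
    ultimately have nz: "cinner n k b b' \<noteq> 0"
      using representation_eq_cinner[OF ind(2) fin(2), of b b' n k] orth unit by simp
    obtain ls c where idx: "(ls, c) \<in> ?I" "b = v (ls, c)"
      using b bij_betw_imp_surj_on[OF v(1)] by (metis imageE surj_pair)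
    obtain ls' c' where idx': "(ls', c') \<in> ?I'" "b' = v' (ls', c')"
      using b' bij_betw_imp_surj_on[OF v'(1)] by (metis imageE surj_pair)
    \<comment> \<open>Since \<open>i - (i - 1) = 1\<close>, exactly one letter is dropped, which
      turns the failure of orthogonality into equality of keys.\<close>
    have "(take (i - 1) ls, c) = (ls', drop (i - (i - 1)) c')"
      using nz idx idx' v(2) v'(2) assms(4)
        basis_vectors_orthogonal[OF idx(1) idx'(1), of b b'] by auto
    then show "\<kappa> b = \<kappa>' b'"
      using idx idx' \<kappa> \<kappa>' assms(3) by (simp add: drop_Suc)
  next
    fix p :: "nat list list \<times> nat list"
    obtain ls c where p: "p = (ls, c)" by (cases p)
    \<comment> \<open>A key leaves open only the first letter of the suffix. The right side may
      contain values of \<open>v'\<close> outside the index set, so only an inclusion is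
      claimed.\<close>
    have "{b' \<in> B'. \<kappa>' b' = p} \<subseteq> {v' (ls, 1 # c), v' (ls, 2 # c)}"
    proof
      fix b' assume "b' \<in> {b' \<in> B'. \<kappa>' b' = p}"
      then obtain c' where c': "(ls, c') \<in> ?I'" "b' = v' (ls, c')" "tl c' = c"
        using v'(1) \<kappa>' p by (fastforce simp: bij_betw_def)
      then have "length c' = n - (i - 1)" "set c' \<subseteq> {1, 2}"
        by (auto simp: basis_index_def)
      \<comment> \<open>The suffix has length \<open>n - (i - 1) \<ge> 1\<close>, so
        \<open>tl\<close> really removes a letter.\<close>
      then have "c' = 1 # c \<or> c' = 2 # c"
        using c'(3) assms(3,4) by (cases c') auto
      then show "b' \<in> {v' (ls, 1 # c), v' (ls, 2 # c)}" using c' by auto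
    qed
    then have "card {b' \<in> B'. \<kappa>' b' = p} \<le> card {v' (ls, 1 # c), v' (ls, 2 # c)}"
      by (rule card_mono[rotated]) simp
    also have "\<dots> \<le> 2" by (simp add: card_insert_if)
    finally show "card {b' \<in> B'. \<kappa>' b' = p} \<le> 2" .
  qed (use fin ind span in auto)
qed

end
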